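(* Let $H$ be a connected graph with minimum degree $d:=\delta(H)\ge 3$ and $s:=|V(H)|$ vertices. Then $$\mathrm{sat}(n,\mathcal{M}(H))\le \left((d-1)+\frac{\binom{s-1}{2}+\binom{d}{2}-(d-1)(s-1)}{\binom{s-1}{d-1}+(s-1)-d}\right)n+O(1),$$ where the $O(1)$ term is bounded by a constant depending only on $H$ (as $n\to\infty$).
   Context: All graphs are finite and simple. For a family $\mathcal{F}$ of graphs, a graph $G$ is $\mathcal{F}$-saturated if $G$ contains no member of $\mathcal{F}$ as a subgraph, but $G+e$ does for every edge $e$ not in $G$. The saturation number $\mathrm{sat}(n,\mathcal{F})$ is the minimum number of edges in an $n$-vertex $\mathcal{F}$-saturated graph. For a graph $H$, $\mathcal{M}(H)$ denotes the class of graphs containing $H$ as a minor; thus an $\mathcal{M}(H)$-saturated graph is a graph with no $H$ minor such that adding any missing edge creates an $H$ minor. *)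

theory Defs
  imports Complex_Main "HOL-Library.Ramsey"
begin

record 'a ugraph =
  verts :: "'a set"
  edges :: "'a set set"

text \<open>Finite simple graphs; \<^term>\<open>nsets V 2\<close> is the set of 2-element subsets of \<open>V\<close>.\<close>

definition simple_graph :: "'a ugraph \<Rightarrow> bool" where
  "simple_graph G \<longleftrightarrow> finite (verts G) \<and> edges G \<subseteq> nsets (verts G) 2"

definition degree :: "'a ugraph \<Rightarrow> 'a \<Rightarrow> nat" where
  "degree G v = card {e \<in> edges G. v \<in> e}"

definition min_degree :: "'a ugraph \<Rightarrow> nat" where
  "min_degree G = Min (degree G ` verts G)"

definition connected_graph :: "'a ugraph \<Rightarrow> bool" where
  "connected_graph G \<longleftrightarrow> verts G \<noteq> {} \<and>
     (\<forall>u\<in>verts G. \<forall>v\<in>verts G. (u, v) \<in> {(x, y). {x, y} \<in> edges G}\<^sup>*)"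

definition induced :: "'a ugraph \<Rightarrow> 'a set \<Rightarrow> 'a ugraph" where
  "induced G S = \<lparr>verts = S, edges = {e \<in> edges G. e \<subseteq> S}\<rparr>"

definition add_edge :: "'a ugraph \<Rightarrow> 'a set \<Rightarrow> 'a ugraph" where
  "add_edge G e = G\<lparr>edges := insert e (edges G)\<rparr>"

text \<open>\<open>G\<close> has a (not necessarily induced) subgraph isomorphic to \<open>F\<close>.\<close>

definition contains :: "'b ugraph \<Rightarrow> 'a ugraph \<Rightarrow> bool" where
  "contains G F \<longleftrightarrow> (\<exists>f. inj_on f (verts F) \<and> f ` verts F \<subseteq> verts G \<and>
     (\<forall>e\<in>edges F. f ` e \<in> edges G))"

text \<open>\<open>H\<close> is a minor of \<open>G\<close>: contracting the pairwise disjoint connected branch sets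
  \<open>B v\<close> in \<open>G\<close> and deleting vertices and edges yields \<open>H\<close>.\<close>

definition has_minor :: "'b ugraph \<Rightarrow> 'a ugraph \<Rightarrow> bool" where
  "has_minor G H \<longleftrightarrow> (\<exists>B :: 'a \<Rightarrow> 'b set.
     (\<forall>v\<in>verts H. B v \<subseteq> verts G \<and> connected_graph (induced G (B v))) \<and>
     (\<forall>u\<in>verts H. \<forall>v\<in>verts H. u \<noteq> v \<longrightarrow> B u \<inter> B v = {}) \<and>
     (\<forall>u v. {u, v} \<in> edges H \<longrightarrow> (\<exists>x\<in>B u. \<exists>y\<in>B v. {x, y} \<in> edges G)))"

definition saturated :: "'a ugraph set \<Rightarrow> 'b ugraph \<Rightarrow> bool" where
  "saturated \<F> G \<longleftrightarrow> simple_graph G \<and>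
     \<not> (\<exists>F\<in>\<F>. contains G F) \<and>
     (\<forall>e \<in> nsets (verts G) 2 - edges G. \<exists>F\<in>\<F>. contains (add_edge G e) F)"

text \<open>Every finite graph has an isomorphic copy with vertices in \<^typ>\<open>nat\<close>, so families of
  graphs and \<open>n\<close>-vertex graphs are taken over \<^typ>\<open>nat\<close>. If no \<open>n\<close>-vertex
  \<open>\<F>\<close>-saturated graph exists, the infimum below is the junk value \<open>0\<close>; the lemma
  \<open>ex_saturated_minor_class\<close> excludes this for \<open>\<F> = minor_class H\<close> when \<open>H\<close> has an edge.\<close>

definition sat :: "nat \<Rightarrow> nat ugraph set \<Rightarrow> nat" where
  "sat n \<F> = Inf {card (edges G) |G :: nat ugraph. card (verts G) = n \<and> saturated \<F> G}"

definition minor_class :: "'a ugraph \<Rightarrow> nat ugraph set" where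
  "minor_class H = {G. simple_graph G \<and> has_minor G H}"

lemma ex_saturated_minor_class:
  fixes H :: "'a ugraph"
  assumes "simple_graph H" and "edges H \<noteq> {}"
  shows "\<exists>G :: nat ugraph. card (verts G) = n \<and> saturated (minor_class H) G"
proof -
  define gr :: "nat set set \<Rightarrow> nat ugraph" where "gr E = \<lparr>verts = {..<n}, edges = E\<rparr>" for E
  define P where "P E \<longleftrightarrow> E \<subseteq> nsets {..<n} 2 \<and> \<not> (\<exists>F\<in>minor_class H. contains (gr E) F)" for E
  obtain u v where uv: "{u, v} \<in> edges H"
  proof -
    obtain e where "e \<in> edges H" using assms(2) by blast
    moreover from this have "card e = 2"
      using assms(1) by (auto simp: simple_graph_def nsets_def)
    ultimately show ?thesis using that by (auto simp: card_2_iff)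
  qed
  have "P {}"
    using uv by (fastforce simp: P_def gr_def contains_def minor_class_def has_minor_def)
  moreover have fin: "finite (nsets {..<n} 2)" by (simp add: finite_imp_finite_nsets)
  then have "finite {E. P E}"
    by (rule_tac finite_subset[of _ "Pow (nsets {..<n} 2)"]) (auto simp: P_def)
  ultimately obtain E where E: "P E" and max: "\<And>E'. P E' \<Longrightarrow> E \<subseteq> E' \<Longrightarrow> E' = E"
    using finite_has_maximal[of "{E. P E}"] by blast
  have "\<exists>F\<in>minor_class H. contains (add_edge (gr E) e) F"
    if "e \<in> nsets {..<n} 2 - E" for e
  proof (rule ccontr)
    assume "\<not> ?thesis"
    then have "P (insert e E)" using that E by (auto simp: P_def gr_def add_edge_def)
    with max[of "insert e E"] that show False by auto
  qed
  then have "saturated (minor_class H) (gr E)"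
    using E by (auto simp: saturated_def simple_graph_def P_def gr_def)
  moreover have "card (verts (gr E)) = n" by (simp add: gr_def)
  ultimately show ?thesis by blast
qed

end

theory Submission imports Defs begin

text \<open>Let \<open>t \<le> d - 1\<close> be maximal such that no set of at most \<open>t\<close> vertices separates \<open>H\<close>. Glue
  \<open>b\<close> copies \<open>K i\<close> of the complete graph on \<open>s - 1\<close> vertices along a common set \<open>T\<close> of \<open>t\<close>
  vertices, and attach pendant vertices \<open>q\<close>, each joined to its own \<open>(d - 1)\<close>-subset \<open>nb q\<close> of one
  clique, \<open>nb q\<close> not being contained in \<open>T\<close>. In a model of \<open>H\<close> at most \<open>t\<close> branch sets meet \<open>T\<close>,
  so by the choice of \<open>t\<close> the others all live around one clique \<open>K i\<close>; a branch set missing \<open>K i\<close>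
  would be a single pendant vertex, of degree less than \<open>d\<close>; hence \<open>s\<close> disjoint branch sets
  meet a set of \<open>s - 1\<close> vertices, which is absurd. An edge added around one clique, or
  between two of them when \<open>t = d - 1\<close>, yields a connected set with \<open>d\<close> neighbours in a clique
  outside of it, hence \<open>H\<close>. If \<open>t < d - 1\<close>, an edge between two cliques
  supplies the missing vertex of a separator of size \<open>t + 1\<close>. Using just enough cliques to
  accommodate \<open>n\<close> vertices gives the density, with equality when \<open>t = d - 1\<close>.\<close>

section \<open>Neighbourhoods, separations and connected vertex sets\<close>

definition nbrs :: "'a ugraph \<Rightarrow> 'a \<Rightarrow> 'a set" where
  "nbrs G v = {u. {v, u} \<in> edges G}"

definition separation :: "'a ugraph \<Rightarrow> 'a set \<Rightarrow> 'a set \<Rightarrow> 'a set \<Rightarrow> bool" where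
  "separation G Z P Q \<longleftrightarrow> verts G = Z \<union> P \<union> Q \<and> P \<noteq> {} \<and> Q \<noteq> {} \<and>
     Z \<inter> P = {} \<and> Z \<inter> Q = {} \<and> P \<inter> Q = {} \<and> (\<forall>u\<in>P. \<forall>v\<in>Q. {u, v} \<notin> edges G)"

definition separable :: "'a ugraph \<Rightarrow> nat \<Rightarrow> bool" where
  "separable G k \<longleftrightarrow> (\<exists>Z P Q. separation G Z P Q \<and> card Z = k)"

lemma separationD:
  assumes "separation G Z P Q"
  shows "verts G = Z \<union> P \<union> Q" "P \<noteq> {}" "Q \<noteq> {}"
    "Z \<inter> P = {}" "Z \<inter> Q = {}" "P \<inter> Q = {}"
    "u \<in> P \<Longrightarrow> v \<in> Q \<Longrightarrow> {u, v} \<notin> edges G"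
  using assms unfolding separation_def by simp_all

lemma simple_graph_edgeD:
  assumes "simple_graph G" "{u, v} \<in> edges G"
  shows "u \<noteq> v" "u \<in> verts G" "v \<in> verts G"
proof -
  have "{u, v} \<in> nsets (verts G) 2" using assms unfolding simple_graph_def by blast
  then have "u \<in> verts G \<and> v \<in> verts G \<and> u \<noteq> v" by (rule doubleton_in_nsets_2[THEN iffD1])
  then show "u \<noteq> v" "u \<in> verts G" "v \<in> verts G" by blast+
qed

lemma degree_eq_card_nbrs:
  assumes "simple_graph G"
  shows "degree G v = card (nbrs G v)"
proof -
  have "{e \<in> edges G. v \<in> e} = (\<lambda>u. {v, u}) ` nbrs G v"
  proof (intro equalityI subsetI)
    fix e assume e: "e \<in> {e \<in> edges G. v \<in> e}"
    then have "card e = 2" using assms by (auto simp: simple_graph_def nsets_def)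
    then obtain a c where "e = {a, c}" by (auto simp: card_2_iff)
    with e show "e \<in> (\<lambda>u. {v, u}) ` nbrs G v" by (auto simp: nbrs_def insert_commute)
  qed (auto simp: nbrs_def)
  moreover have "inj_on (\<lambda>u. {v, u}) (nbrs G v)"
    by (auto simp: inj_on_def doubleton_eq_iff)
  ultimately show ?thesis by (simp add: degree_def card_image)
qed

text \<open>Induction along a walk that starts in \<open>A\<close>. In this form connectedness
  confines a branch set to a region or to a single vertex.\<close>

lemma connected_induced_closed:
  assumes "connected_graph (induced G S)" "A \<subseteq> S" "A \<noteq> {}"
    and closed: "\<And>x y. x \<in> A \<Longrightarrow> y \<in> S \<Longrightarrow> {x, y} \<in> edges G \<Longrightarrow> y \<in> A"
  shows "A = S"
proof -
  obtain a where a: "a \<in> A" using assms(3) by auto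
  have "v \<in> A" if "v \<in> S" for v
  proof -
    have "(a, v) \<in> {(x, y). {x, y} \<in> edges (induced G S)}\<^sup>*"
      using assms(1,2) a that by (auto simp: connected_graph_def induced_def)
    then show ?thesis
      by (induction rule: rtrancl_induct) (auto simp: a induced_def intro: closed)
  qed
  with assms(2) show ?thesis by auto
qed

lemma connected_induced_singleton: "connected_graph (induced G {x})"
  by (auto simp: connected_graph_def induced_def)

lemma connected_induced_insert:
  assumes "connected_graph (induced G S)" "x \<in> S" "{x, y} \<in> edges G"
  shows "connected_graph (induced G (insert y S))"
proof -
  let ?R = "\<lambda>S. {(x, y). {x, y} \<in> edges (induced G S)}"
  have "?R S \<subseteq> ?R (insert y S)" by (auto simp: induced_def)
  then have mono: "(?R S)\<^sup>* \<subseteq> (?R (insert y S))\<^sup>*" by (rule rtrancl_mono)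
  have old: "(u, v) \<in> (?R (insert y S))\<^sup>*" if "u \<in> S" "v \<in> S" for u v
    using assms(1) that mono by (auto simp: connected_graph_def induced_def)
  have xy: "(x, y) \<in> (?R (insert y S))\<^sup>*" "(y, x) \<in> (?R (insert y S))\<^sup>*"
    using assms(2,3) by (auto simp: induced_def insert_commute)
  have "(u, v) \<in> (?R (insert y S))\<^sup>*" if "u \<in> insert y S" "v \<in> insert y S" for u v
  proof -
    have "(u, x) \<in> (?R (insert y S))\<^sup>*" "(x, v) \<in> (?R (insert y S))\<^sup>*"
      using that old xy assms(2) by auto
    then show ?thesis by (rule rtrancl_trans)
  qed
  then show ?thesis by (auto simp: connected_graph_def induced_def)
qed

lemma connected_induced_image:
  assumes "connected_graph (induced F S)" and f: "\<And>e. e \<in> edges F \<Longrightarrow> f ` e \<in> edges G"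
  shows "connected_graph (induced G (f ` S))"
proof -
  have step: "(f u, f v) \<in> {(x, y). {x, y} \<in> edges (induced G (f ` S))}\<^sup>*"
    if "(u, v) \<in> {(x, y). {x, y} \<in> edges (induced F S)}\<^sup>*" for u v
    using that
  proof (induction rule: rtrancl_induct)
    case (step y z)
    then have "(f y, f z) \<in> {(x, y). {x, y} \<in> edges (induced G (f ` S))}"
      using f[of "{y, z}"] by (auto simp: induced_def)
    with step.IH show ?case by (rule rtrancl.rtrancl_into_rtrancl)
  qed simp
  then show ?thesis using assms(1) by (auto simp: connected_graph_def induced_def)
qed

lemma connected_not_separable_0:
  assumes "connected_graph G" "simple_graph G"
  shows "\<not> separable G 0"
proof
  assume "separable G 0"
  then obtain Z P Q where sep: "separation G Z P Q" "card Z = 0" by (auto simp: separable_def)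
  note * = separationD[OF sep(1)]
  \<comment> \<open>An infinite \<open>Z\<close> would also have \<open>card Z = 0\<close>, hence
    the appeal to finiteness.\<close>
  have "finite Z" using assms(2) *(1) by (auto simp: simple_graph_def)
  then have "verts G = P \<union> Q" using *(1) sep(2) by auto
  have "edges (induced G (verts G)) = edges G"
    using assms(2) by (auto simp: induced_def simple_graph_def nsets_def)
  then have "connected_graph (induced G (verts G))"
    using assms(1) by (auto simp: connected_graph_def induced_def)
  from connected_induced_closed[OF this, of P] * \<open>verts G = P \<union> Q\<close> show False by blast
qed

section \<open>Minor models and their transfer along embeddings\<close>

definition minor_model :: "'b ugraph \<Rightarrow> 'a ugraph \<Rightarrow> ('a \<Rightarrow> 'b set) \<Rightarrow> bool" where
  "minor_model G H B \<longleftrightarrow>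
     (\<forall>v\<in>verts H. B v \<subseteq> verts G \<and> connected_graph (induced G (B v))) \<and>
     (\<forall>u\<in>verts H. \<forall>v\<in>verts H. u \<noteq> v \<longrightarrow> B u \<inter> B v = {}) \<and>
     (\<forall>u v. {u, v} \<in> edges H \<longrightarrow> (\<exists>x\<in>B u. \<exists>y\<in>B v. {x, y} \<in> edges G))"

lemma has_minor_iff_model: "has_minor G H \<longleftrightarrow> (\<exists>B. minor_model G H B)"
  by (simp only: has_minor_def minor_model_def)

lemma minor_modelD:
  assumes "minor_model G H B"
  shows "v \<in> verts H \<Longrightarrow> B v \<subseteq> verts G"
    and "v \<in> verts H \<Longrightarrow> connected_graph (induced G (B v))"
    and "u \<in> verts H \<Longrightarrow> v \<in> verts H \<Longrightarrow> u \<noteq> v \<Longrightarrow> B u \<inter> B v = {}"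
    and "{u, v} \<in> edges H \<Longrightarrow> \<exists>x\<in>B u. \<exists>y\<in>B v. {x, y} \<in> edges G"
  using assms unfolding minor_model_def by simp_all

lemma has_minorI:
  assumes "\<And>v. v \<in> verts H \<Longrightarrow> B v \<subseteq> verts G"
    and "\<And>v. v \<in> verts H \<Longrightarrow> connected_graph (induced G (B v))"
    and "\<And>u v. u \<in> verts H \<Longrightarrow> v \<in> verts H \<Longrightarrow> u \<noteq> v \<Longrightarrow> B u \<inter> B v = {}"
    and "\<And>u v. {u, v} \<in> edges H \<Longrightarrow> \<exists>x\<in>B u. \<exists>y\<in>B v. {x, y} \<in> edges G"
  shows "has_minor G H"
  unfolding has_minor_iff_model minor_model_def
  by (rule exI[of _ B], intro conjI ballI allI impI) (rule assms; assumption)+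

text \<open>A model in a subgraph is carried into \<open>G\<close> by the embedding, and
  \<open>G\<close> is itself a member of the class when it has the minor. Saturation thereby becomes
  a statement about minors alone.\<close>

lemma exists_contains_minor_class_iff:
  fixes G :: "nat ugraph"
  assumes "simple_graph G" "simple_graph H"
  shows "(\<exists>F\<in>minor_class H. contains G F) \<longleftrightarrow> has_minor G H"
proof
  assume "has_minor G H"
  moreover have "contains G G" unfolding contains_def by (rule exI[of _ id]) auto
  ultimately show "\<exists>F\<in>minor_class H. contains G F"
    using assms by (auto simp: minor_class_def)
next
  assume "\<exists>F\<in>minor_class H. contains G F"
  then obtain F :: "nat ugraph" and f where F: "has_minor F H" and f: "inj_on f (verts F)"
    "f ` verts F \<subseteq> verts G" "\<And>e. e \<in> edges F \<Longrightarrow> f ` e \<in> edges G"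
    by (auto simp: minor_class_def contains_def)
  from F obtain B where "minor_model F H B" by (auto simp: has_minor_iff_model)
  note B = minor_modelD[OF this]
  show "has_minor G H"
  proof (rule has_minorI[where B = "\<lambda>v. f ` B v"])
    fix u v assume "{u, v} \<in> edges H"
    then obtain x y where "x \<in> B u" "y \<in> B v" "{x, y} \<in> edges F" using B(4) by blast
    with f(3)[of "{x, y}"] show "\<exists>x\<in>f ` B u. \<exists>y\<in>f ` B v. {x, y} \<in> edges G" by auto
  next
    fix u v assume "u \<in> verts H" "v \<in> verts H" "u \<noteq> v"
    then show "f ` B u \<inter> f ` B v = {}"
      using inj_on_image_Int[OF f(1) B(1) B(1), of u v] B(3)[of u v] by simp
  next
    fix v assume v: "v \<in> verts H"
    then show "f ` B v \<subseteq> verts G" using B(1) f(2) by blast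
    show "connected_graph (induced G (f ` B v))"
      using B(2)[OF v] f(3) by (rule connected_induced_image)
  qed
qed

text \<open>Picking a point of \<open>A\<close> from each \<open>B v\<close> is injective by
  disjointness. This will bound the branch sets that meet the core, a clique, or the neighbourhood
  of a pendant vertex.\<close>

lemma card_le_if_disjoint_meeting:
  assumes "finite A" "\<And>v. v \<in> V \<Longrightarrow> B v \<inter> A \<noteq> {}"
    "\<And>u v. u \<in> V \<Longrightarrow> v \<in> V \<Longrightarrow> u \<noteq> v \<Longrightarrow> B u \<inter> B v = {}"
  shows "card V \<le> card A"
proof -
  have "\<forall>v\<in>V. \<exists>x. x \<in> B v \<inter> A" using assms(2) by blast
  then obtain f where f: "\<forall>v\<in>V. f v \<in> B v \<inter> A" by metis
  have "inj_on f V"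
  proof (rule inj_onI, rule ccontr)
    fix u v assume "u \<in> V" "v \<in> V" "f u = f v" "u \<noteq> v"
    moreover from this have "f u \<in> B u" "f v \<in> B v" using f by auto
    ultimately show False using assms(3)[of u v] by (metis disjoint_iff)
  qed
  then show ?thesis using assms(1) f by (intro card_inj_on_le[of f]) auto
qed

section \<open>Explicit models with one large branch set\<close>

lemma inj_on_combine:
  assumes "inj_on f A" "inj_on g C" "A \<inter> C = {}" "f ` A \<inter> g ` C = {}"
  shows "inj_on (\<lambda>x. if x \<in> A then f x else g x) (A \<union> C)"
proof (rule inj_onI)
  fix x y assume *: "x \<in> A \<union> C" "y \<in> A \<union> C" "(if x \<in> A then f x else g x) = (if y \<in> A then f y else g y)"
  have ne: "f u \<noteq> g v" if "u \<in> A" "v \<in> C" for u v using assms(4) that by blast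
  show "x = y"
  proof (cases "x \<in> A")
    case True
    then show ?thesis using * assms(1) ne by (cases "y \<in> A") (simp_all add: inj_on_eq_iff)
  next
    case False
    then show ?thesis using * assms(2) ne[of y x] by (cases "y \<in> A") (simp_all add: inj_on_eq_iff)
  qed
qed

text \<open>Every branch set except that of \<open>w\<close> is a singleton; all minors created by
  an added edge will have this shape.\<close>

lemma has_minor_one_large_branch_set:
  assumes H: "simple_graph H" and W: "W \<subseteq> verts G" "connected_graph (induced G W)"
    and f: "inj_on f (verts H - {w})" "f ` (verts H - {w}) \<subseteq> verts G - W"
    and old: "\<And>u v. {u, v} \<in> edges H \<Longrightarrow> u \<noteq> w \<Longrightarrow> v \<noteq> w \<Longrightarrow> {f u, f v} \<in> edges G"
    and new: "\<And>v. {w, v} \<in> edges H \<Longrightarrow> \<exists>x\<in>W. {x, f v} \<in> edges G"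
  shows "has_minor G H"
proof -
  let ?B = "\<lambda>v. if v = w then W else {f v}"
  show ?thesis
  proof (rule has_minorI[where B = ?B])
    fix u v assume e: "{u, v} \<in> edges H"
    have "u \<noteq> v" by (rule simple_graph_edgeD[OF H e])
    then show "\<exists>x\<in>?B u. \<exists>y\<in>?B v. {x, y} \<in> edges G" using e old[OF e] new[of v] new[of u]
      by (auto simp: insert_commute)
  qed (use f W connected_induced_singleton in \<open>auto simp: inj_on_def\<close>)
qed

text \<open>\<open>W\<close> represents \<open>w\<close>, the neighbours of \<open>w\<close> go to
  \<open>M\<close>, and the other vertices of \<open>H\<close> are exactly enough to fill the rest
  of \<open>K\<close>. Edges of \<open>H\<close> that avoid \<open>w\<close> come from the
  clique.\<close>

lemma has_minor_clique_plus_connected_set: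
  assumes H: "simple_graph H" "w \<in> verts H" "M \<subseteq> K" "card M = card (nbrs H w)"
    and K: "finite K" "K \<subseteq> verts G" "card K = card (verts H) - 1" "nsets K 2 \<subseteq> edges G"
    and W: "W \<subseteq> verts G" "connected_graph (induced G W)" "W \<inter> K = {}"
    and M: "\<And>m. m \<in> M \<Longrightarrow> \<exists>x\<in>W. {x, m} \<in> edges G"
  shows "has_minor G H"
proof -
  have fin: "finite (verts H)" using H by (simp add: simple_graph_def)
  have sub: "nbrs H w \<subseteq> verts H - {w}"
    using simple_graph_edgeD[OF H(1)] by (auto simp: nbrs_def)
  then have finN: "finite (nbrs H w)" using fin finite_subset by blast
  have finM: "finite M" using H(3) K(1) finite_subset by auto
  define R where "R = verts H - {w} - nbrs H w"
  have "card R = card (verts H) - 1 - card (nbrs H w)"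
    using sub fin finN H(2) by (simp add: R_def card_Diff_subset)
  also have "\<dots> = card (K - M)" using K H finM by (simp add: card_Diff_subset)
  finally obtain g where g: "bij_betw g R (K - M)"
    using finite_same_card_bij[of R "K - M"] fin K(1) by (auto simp: R_def)
  obtain h where h: "bij_betw h (nbrs H w) M"
    using finite_same_card_bij[of "nbrs H w" M] finN finM H(4) by auto
  define f where "f v = (if v \<in> nbrs H w then h v else g v)" for v
  have V: "verts H - {w} = nbrs H w \<union> R" "nbrs H w \<inter> R = {}" using sub by (auto simp: R_def)
  have inj: "inj_on f (verts H - {w})"
    unfolding V f_def using g h V by (intro inj_on_combine) (auto simp: bij_betw_def)
  have fK: "f v \<in> K" if "v \<in> verts H - {w}" for v
    using that V g h H(3) unfolding f_def bij_betw_def by auto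
  show ?thesis
  proof (rule has_minor_one_large_branch_set[OF H(1) W(1,2) inj])
    show "f ` (verts H - {w}) \<subseteq> verts G - W" using fK K W by auto
    fix u v assume uv: "{u, v} \<in> edges H" "u \<noteq> w" "v \<noteq> w"
    then have "f u \<noteq> f v" "f u \<in> K" "f v \<in> K"
      using inj fK simple_graph_edgeD[OF H(1) uv(1)] by (auto simp: inj_on_def)
    then show "{f u, f v} \<in> edges G" using K by auto
  next
    fix v assume "{w, v} \<in> edges H"
    then have "v \<in> nbrs H w" by (simp add: nbrs_def)
    then have "f v \<in> M" using h by (auto simp: f_def bij_betw_def)
    then show "\<exists>x\<in>W. {x, f v} \<in> edges G" by (rule M)
  qed
qed

text \<open>The vertex left over when all but one vertex of a separator of \<open>H\<close> is placed on
  \<open>K\<^sub>1 \<inter> K\<^sub>2\<close> is represented by a connected set \<open>W\<close> linking the two cliques.\<close>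

lemma has_minor_two_linked_cliques:
  assumes H: "simple_graph H" "separable H (Suc (card (K1 \<inter> K2)))"
    and K1: "finite K1" "K1 \<subseteq> verts G" "card K1 = card (verts H) - 1" "nsets K1 2 \<subseteq> edges G"
    and K2: "finite K2" "K2 \<subseteq> verts G" "card K2 = card (verts H) - 1" "nsets K2 2 \<subseteq> edges G"
    and W: "W \<subseteq> verts G" "connected_graph (induced G W)"
      "W \<inter> K1 = {x}" "W \<inter> K2 = {y}" "x \<notin> K2" "y \<notin> K1"
  shows "has_minor G H"
proof -
  define T where "T = K1 \<inter> K2"
  have fin: "finite (verts H)" using H by (simp add: simple_graph_def)
  obtain Z P Q where sep: "separation H Z P Q" and cZ: "card Z = Suc (card T)"
    using H(2) by (auto simp: separable_def T_def)
  note Z = separationD(1-6)[OF sep] and PQ = separationD(7)[OF sep]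
  have finZ: "finite Z" "finite P" "finite Q" using fin Z(1) by auto
  have finT: "finite T" using K1 by (simp add: T_def)
  \<comment> \<open>\<open>z\<close> is the separator vertex represented by \<open>W\<close>; the
    others number \<open>card T\<close> and fill \<open>T\<close>.\<close>
  obtain z where z: "z \<in> Z" using cZ by fastforce
  have cH: "card (verts H) = Suc (card T) + card P + card Q"
    using Z cZ finZ by (simp add: card_Un_disjoint Int_Un_distrib2)
  have pos: "card P > 0" "card Q > 0" using Z finZ by (auto simp: card_gt_0_iff)
  have xT: "x \<in> K1 - T" "y \<in> K2 - T" "x \<notin> T" "y \<notin> T" using W by (auto simp: T_def)
  have cT: "card (insert x T) = Suc (card T)" "card (insert y T) = Suc (card T)" using xT finT by auto
  \<comment> \<open>The difference equals \<open>card P + card Q - 1\<close>, so \<open>P\<close>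
    fits because \<open>Q\<close> is nonempty; the symmetric count places \<open>Q\<close> in the
    second clique.\<close>
  have "card (K1 - insert x T) = card (verts H) - 1 - Suc (card T)"
    using K1 xT finT cT by (subst card_Diff_subset) (auto simp: T_def)
  then have "card P \<le> card (K1 - insert x T)" using cH pos by simp
  then obtain p where p: "inj_on p P" "p ` P \<subseteq> K1 - insert x T"
    using inj_on_iff_card_le[of P "K1 - insert x T"] finZ K1 by auto
  have "card (K2 - insert y T) = card (verts H) - 1 - Suc (card T)"
    using K2 xT finT cT by (subst card_Diff_subset) (auto simp: T_def)
  then have "card Q \<le> card (K2 - insert y T)" using cH pos by simp
  then obtain q where q: "inj_on q Q" "q ` Q \<subseteq> K2 - insert y T"
    using inj_on_iff_card_le[of Q "K2 - insert y T"] finZ K2 by auto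
  have "card (Z - {z}) = card T" using z cZ by simp
  then obtain h where h: "bij_betw h (Z - {z}) T"
    using finite_same_card_bij[of "Z - {z}" T] finZ finT by auto
  define f where "f v = (if v \<in> Z - {z} then h v else if v \<in> P then p v else q v)" for v
  have V: "verts H - {z} = (Z - {z}) \<union> (P \<union> Q)" using Z z by auto
  have hT: "h v \<in> T" if "v \<in> Z - {z}" for v using h that by (rule bij_betw_apply)
  have pK: "p v \<in> K1" "p v \<noteq> x" "p v \<notin> T" if "v \<in> P" for v using subsetD[OF p(2) imageI[OF that]] by simp_all
  have qK: "q v \<in> K2" "q v \<noteq> y" "q v \<notin> T" if "v \<in> Q" for v using subsetD[OF q(2) imageI[OF that]] by simp_all
  have pq: "p u \<noteq> q v" if "u \<in> P" "v \<in> Q" for u v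
    using pK[OF that(1)] qK[OF that(2)] by (auto simp: T_def)
  have fZ: "f v = h v" if "v \<in> Z - {z}" for v using that by (simp add: f_def)
  have fP: "f v = p v" if "v \<in> P" for v using that Z(4) by (auto simp: f_def)
  have fQ: "f v = q v" if "v \<in> Q" for v using that Z(5,6) by (auto simp: f_def)
  have inj_pq: "inj_on (\<lambda>v. if v \<in> P then p v else q v) (P \<union> Q)"
  proof (rule inj_on_combine[OF p(1) q(1) Z(6)])
    show "p ` P \<inter> q ` Q = {}" using pq by auto
  qed
  have inj: "inj_on f (verts H - {z})"
    unfolding V f_def
  proof (rule inj_on_combine[OF bij_betw_imp_inj_on[OF h] inj_pq])
    show "(Z - {z}) \<inter> (P \<union> Q) = {}" using Z(4,5) by blast
    have "h ` (Z - {z}) \<subseteq> T" using hT by (rule image_subsetI)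
    moreover have "(\<lambda>v. if v \<in> P then p v else q v) ` (P \<union> Q) \<subseteq> - T"
      using pK(3) qK(3) by (intro image_subsetI) auto
    ultimately show "h ` (Z - {z}) \<inter> (\<lambda>v. if v \<in> P then p v else q v) ` (P \<union> Q) = {}"
      by (simp only: disjoint_eq_subset_Compl) (meson subset_trans Compl_anti_mono compl_le_swap1)
  qed
  have TK: "T \<subseteq> K1 - {x}" "T \<subseteq> K2 - {y}" using xT(3,4) by (auto simp: T_def)
  have f1: "f v \<in> K1 - {x}" if "v \<in> (Z - {z}) \<union> P" for v
    using that hT TK(1) pK fZ fP by (metis Diff_iff UnE singletonD subsetD)
  have f2: "f v \<in> K2 - {y}" if "v \<in> (Z - {z}) \<union> Q" for v
    using that hT TK(2) qK fZ fQ by (metis Diff_iff UnE singletonD subsetD)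
  have xW: "x \<in> W" "y \<in> W" "x \<in> K1" "y \<in> K2" using W(3,4) by blast+
  show ?thesis
  proof (rule has_minor_one_large_branch_set[OF H(1) W(1,2) inj])
    have "f v \<in> K1 - {x} \<or> f v \<in> K2 - {y}" if "v \<in> verts H - {z}" for v
      using that f1[of v] f2[of v] V by blast
    moreover have "K1 - {x} \<subseteq> verts G - W" "K2 - {y} \<subseteq> verts G - W"
      using K1(2) K2(2) W(3,4) by blast+
    ultimately show "f ` (verts H - {z}) \<subseteq> verts G - W" by blast
  next
    fix u v assume uv: "{u, v} \<in> edges H" "u \<noteq> z" "v \<noteq> z"
    note e = simple_graph_edgeD[OF H(1) uv(1)]
    have ne: "f u \<noteq> f v" using inj e uv by (auto simp: inj_on_def)
    \<comment> \<open>No edge runs between \<open>P\<close> and \<open>Q\<close>, so an edge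
      avoiding \<open>z\<close> stays within one clique.\<close>
    have "{u, v} \<subseteq> (Z - {z}) \<union> P \<or> {u, v} \<subseteq> (Z - {z}) \<union> Q"
      using e uv Z(1) PQ[of u v] PQ[of v u] by (auto simp: insert_commute)
    then have "f u \<in> K1 \<and> f v \<in> K1 \<or> f u \<in> K2 \<and> f v \<in> K2"
      using f1[of u] f1[of v] f2[of u] f2[of v] by blast
    then have "{f u, f v} \<in> nsets K1 2 \<or> {f u, f v} \<in> nsets K2 2" using ne by simp
    then show "{f u, f v} \<in> edges G" using K1(4) K2(4) by blast
  next
    fix v assume zv: "{z, v} \<in> edges H"
    note e = simple_graph_edgeD[OF H(1) zv]
    then have "v \<in> (Z - {z}) \<union> P \<or> v \<in> (Z - {z}) \<union> Q" using Z(1) by auto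
    then have "f v \<in> K1 - {x} \<or> f v \<in> K2 - {y}" using f1[of v] f2[of v] by blast
    then have "{x, f v} \<in> nsets K1 2 \<or> {y, f v} \<in> nsets K2 2" using xW by auto
    then show "\<exists>x\<in>W. {x, f v} \<in> edges G" using xW K1(4) K2(4) by blast
  qed
qed

section \<open>The construction: cliques glued along a core, with pendant vertices\<close>

text \<open>\<open>T\<close> is the core, \<open>Q\<close> the set of pendants, and
  \<open>blk q\<close> the index of the clique that \<open>q\<close> is attached to.
  \<open>nb_not_sub\<close> gives each pendant a way into its clique off the core, and
  \<open>inj_nb\<close> makes an edge between two pendants of one clique create
  \<open>H\<close>.\<close>

locale glued_cliques =
  fixes T :: "'v set" and K :: "nat \<Rightarrow> 'v set" and b :: nat and Q :: "'v set"
    and blk :: "'v \<Rightarrow> nat" and nb :: "'v \<Rightarrow> 'v set" and d s :: nat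
  assumes b_pos: "0 < b" and d_pos: "0 < d" and finite_Q: "finite Q"
    and finite_K: "i < b \<Longrightarrow> finite (K i)"
    and card_K: "i < b \<Longrightarrow> card (K i) = s - 1"
    and K_Int: "i < b \<Longrightarrow> j < b \<Longrightarrow> i \<noteq> j \<Longrightarrow> K i \<inter> K j = T"
    and T_sub: "i < b \<Longrightarrow> T \<subseteq> K i"
    and Q_K: "i < b \<Longrightarrow> Q \<inter> K i = {}"
    and blk_less: "q \<in> Q \<Longrightarrow> blk q < b"
    and nb_sub: "q \<in> Q \<Longrightarrow> nb q \<subseteq> K (blk q)"
    and card_nb: "q \<in> Q \<Longrightarrow> card (nb q) = d - 1"
    and nb_not_sub: "q \<in> Q \<Longrightarrow> \<not> nb q \<subseteq> T"
    and inj_nb: "inj_on (\<lambda>q. (blk q, nb q)) Q"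
begin

definition G :: "'v ugraph" where
  "G = \<lparr>verts = (\<Union>i<b. K i) \<union> Q,
        edges = (\<Union>i<b. nsets (K i) 2) \<union> (\<Union>q\<in>Q. (\<lambda>a. {q, a}) ` nb q)\<rparr>"

definition region :: "nat \<Rightarrow> 'v set" where
  "region i = (K i - T) \<union> {q \<in> Q. blk q = i}"

lemma verts_G: "verts G = (\<Union>i<b. K i) \<union> Q"
  by (simp add: G_def)

lemma K_verts: "i < b \<Longrightarrow> K i \<subseteq> verts G"
  by (auto simp: verts_G)

lemma clique_edges: "i < b \<Longrightarrow> nsets (K i) 2 \<subseteq> edges G"
  by (auto simp: G_def)

lemma pendant_edge: "q \<in> Q \<Longrightarrow> a \<in> nb q \<Longrightarrow> {q, a} \<in> edges G"
  by (auto simp: G_def)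

lemma edge_cases:
  assumes "{x, y} \<in> edges G"
  obtains (clique) i where "i < b" "x \<in> K i" "y \<in> K i" "x \<noteq> y"
  | (left) "x \<in> Q" "y \<in> nb x"
  | (right) "y \<in> Q" "x \<in> nb y"
proof -
  from assms consider i where "i < b" "{x, y} \<in> nsets (K i) 2"
    | q a where "q \<in> Q" "a \<in> nb q" "{x, y} = {q, a}"
    unfolding G_def by auto
  then show thesis
  proof cases
    case 1
    from 1(2) have "x \<in> K i \<and> y \<in> K i \<and> x \<noteq> y" by (rule doubleton_in_nsets_2[THEN iffD1])
    with 1(1) show thesis using clique by blast
  next
    case 2
    from 2(3) have "x = q \<and> y = a \<or> x = a \<and> y = q" by (simp add: doubleton_eq_iff)
    with 2(1,2) show thesis using left right by blast
  qed
qed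

lemma finite_verts: "finite (verts G)"
  using finite_Q finite_K by (simp add: verts_G)

lemma finite_T: "finite T"
  using T_sub[OF b_pos] finite_K[OF b_pos] by (rule finite_subset)

lemma simple_graph_G: "simple_graph G"
proof -
  have "nsets (K i) 2 \<subseteq> nsets (verts G) 2" if "i < b" for i
    using K_verts[OF that] by (rule nsets_mono)
  moreover have "{q, a} \<in> nsets (verts G) 2" if "q \<in> Q" "a \<in> nb q" for q a
  proof -
    have "a \<in> K (blk q)" using nb_sub that by blast
    moreover have "q \<notin> K (blk q)" using Q_K[OF blk_less] that by blast
    ultimately have "a \<in> verts G \<and> q \<noteq> a" using K_verts[OF blk_less] that by blast
    then show ?thesis using that by (simp add: verts_G)
  qed
  ultimately show ?thesis
    using finite_verts by (auto simp: simple_graph_def G_def)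
qed

text \<open>Pairs inside \<open>T\<close> are shared by all cliques and counted once; each clique
  contributes its other pairs, each pendant its \<open>d - 1\<close> edges.\<close>

lemma card_edges_G:
  "card (edges G) \<le> (card T choose 2) + b * ((s - 1 choose 2) - (card T choose 2)) + card Q * (d - 1)"
proof -
  have fin: "finite (nsets (K i) 2)" if "i < b" for i
    using finite_K[OF that] by (rule finite_imp_finite_nsets)
  have finT: "finite (nsets T 2)" using finite_T by (rule finite_imp_finite_nsets)
  have "edges G \<subseteq> nsets T 2 \<union> (\<Union>i<b. nsets (K i) 2 - nsets T 2) \<union> (\<Union>q\<in>Q. (\<lambda>a. {q, a}) ` nb q)"
    by (auto simp: G_def)
  moreover have "finite (nb q)" if "q \<in> Q" for q
    using nb_sub[OF that] finite_K[OF blk_less[OF that]] by (rule finite_subset)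
  ultimately have "card (edges G) \<le>
      card (nsets T 2 \<union> (\<Union>i<b. nsets (K i) 2 - nsets T 2) \<union> (\<Union>q\<in>Q. (\<lambda>a. {q, a}) ` nb q))"
    using fin finT finite_Q by (intro card_mono) auto
  also have "\<dots> \<le> card (nsets T 2) + card (\<Union>i<b. nsets (K i) 2 - nsets T 2)
      + card (\<Union>q\<in>Q. (\<lambda>a. {q, a}) ` nb q)"
    by (meson add_le_mono card_Un_le order_refl order_trans)
  also have "card (nsets T 2) = card T choose 2" by (rule card_nsets)
  also have "card (\<Union>i<b. nsets (K i) 2 - nsets T 2) \<le> b * ((s - 1 choose 2) - (card T choose 2))"
  proof -
    have "card (nsets (K i) 2 - nsets T 2) = (s - 1 choose 2) - (card T choose 2)" if "i < b" for i
      using that finT nsets_mono[OF T_sub[OF that], of 2]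
      by (simp add: card_Diff_subset card_K)
    then have "(\<Sum>i<b. card (nsets (K i) 2 - nsets T 2)) = b * ((s - 1 choose 2) - (card T choose 2))"
      by simp
    then show ?thesis using card_UN_le[of "{..<b}" "\<lambda>i. nsets (K i) 2 - nsets T 2"] by simp
  qed
  also have "card (\<Union>q\<in>Q. (\<lambda>a. {q, a}) ` nb q) \<le> card Q * (d - 1)"
  proof -
    have "card ((\<lambda>a. {q, a}) ` nb q) = d - 1" if "q \<in> Q" for q
      using card_nb[OF that] by (subst card_image) (auto simp: inj_on_def doubleton_eq_iff)
    then have "(\<Sum>q\<in>Q. card ((\<lambda>a. {q, a}) ` nb q)) = card Q * (d - 1)" by simp
    then show ?thesis using card_UN_le[OF finite_Q, of "\<lambda>q. (\<lambda>a. {q, a}) ` nb q"] by simp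
  qed
  finally show ?thesis by simp
qed

lemma K_notin_Q: "i < b \<Longrightarrow> x \<in> K i \<Longrightarrow> x \<notin> Q"
  using Q_K by blast

lemma K_unique: "i < b \<Longrightarrow> j < b \<Longrightarrow> x \<in> K i \<Longrightarrow> x \<in> K j \<Longrightarrow> x \<notin> T \<Longrightarrow> i = j"
  using K_Int by blast

section \<open>Regions and the absence of an \<open>H\<close> minor\<close>

lemma region_cover:
  assumes "x \<in> verts G" "x \<notin> T"
  obtains i where "i < b" "x \<in> region i"
proof -
  from assms consider i where "i < b" "x \<in> K i" | "x \<in> Q" by (auto simp: verts_G)
  then show thesis
    by cases (use assms(2) that blk_less in \<open>auto simp: region_def\<close>)
qed

text \<open>A vertex off \<open>T\<close> lies in at most one clique, and a pendant has all its
  neighbours in its own clique, so a region can be left only through \<open>T\<close>.\<close>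

lemma region_closed:
  assumes "i < b" "x \<in> region i" "{x, y} \<in> edges G" "y \<notin> T"
  shows "y \<in> region i"
  using assms(3)
proof (cases rule: edge_cases)
  case (clique j)
  then have "x \<in> K i - T" using assms(2) K_notin_Q by (auto simp: region_def)
  then have "i = j" using K_unique[OF assms(1) clique(1), of x] clique(2) by blast
  then show ?thesis using clique assms(4) by (simp add: region_def)
next
  case left
  then have "blk x = i" using assms(1,2) K_notin_Q by (auto simp: region_def)
  then show ?thesis using left nb_sub assms(4) by (auto simp: region_def)
next
  case right
  then have x: "x \<in> K (blk y)" "blk y < b" using nb_sub blk_less by blast+
  then have "x \<in> K i - T" using assms(2) K_notin_Q by (auto simp: region_def)
  then have "i = blk y" using K_unique[OF assms(1) x(2), of x] x(1) by blast
  then show ?thesis using right by (simp add: region_def)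
qed

lemma connected_subset_region:
  assumes "connected_graph (induced G S)" "S \<inter> T = {}" "i < b" "x \<in> S" "x \<in> region i"
  shows "S \<subseteq> region i"
proof -
  have "S \<inter> region i = S"
  proof (rule connected_induced_closed[OF assms(1)])
    fix x y assume "x \<in> S \<inter> region i" "y \<in> S" "{x, y} \<in> edges G"
    then show "y \<in> S \<inter> region i" using region_closed[OF assms(3), of x y] assms(2) by blast
  qed (use assms(4,5) in auto)
  then show ?thesis by blast
qed

lemma not_has_minor:
  assumes H: "simple_graph H" "card (verts H) = s"
    and deg: "\<And>v. v \<in> verts H \<Longrightarrow> d \<le> card (nbrs H v)"
    and sep: "\<And>k. k \<le> card T \<Longrightarrow> \<not> separable H k"
    and ts: "card T < s"
  shows "\<not> has_minor G H"
proof
  assume "has_minor G H"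
  then obtain B where "minor_model G H B" by (auto simp: has_minor_iff_model)
  note B = minor_modelD[OF this]
  have finH: "finite (verts H)" using H(1) by (simp add: simple_graph_def)
  define Z where "Z = {v \<in> verts H. B v \<inter> T \<noteq> {}}"
  have ZH: "Z \<subseteq> verts H" by (auto simp: Z_def)
  have cZ: "card Z \<le> card T"
  proof (rule card_le_if_disjoint_meeting[OF finite_T])
    show "B v \<inter> T \<noteq> {}" if "v \<in> Z" for v using that by (simp add: Z_def)
    show "B u \<inter> B v = {}" if "u \<in> Z" "v \<in> Z" "u \<noteq> v" for u v
      using B(3) that by (simp add: Z_def)
  qed
  have avoid: "B v \<inter> T = {}" if "v \<in> verts H - Z" for v using that by (simp add: Z_def)
  have ne: "B v \<noteq> {}" if "v \<in> verts H" for v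
    using B(2)[OF that] by (auto simp: connected_graph_def induced_def)
  have "Z \<noteq> verts H" using cZ ts H(2) by auto
  \<comment> \<open>\<open>card T < s\<close> leaves a branch set off the core; its region will turn
    out to contain all branch sets off the core.\<close>
  then obtain v0 where v0: "v0 \<in> verts H - Z" using ZH by blast
  then obtain x0 where x0: "x0 \<in> B v0" using ne by blast
  have "x0 \<in> verts G" "x0 \<notin> T" using x0 v0 B(1)[of v0] avoid[of v0] by blast+
  then obtain i where i: "i < b" "x0 \<in> region i" by (rule region_cover)
  define P where "P = {v \<in> verts H - Z. B v \<subseteq> region i}"
  have inP: "v \<in> P" if "v \<in> verts H - Z" "x \<in> B v" "x \<in> region i" for v x
    using that connected_subset_region[OF B(2)[of v] avoid[of v] i(1) that(2,3)]
    by (simp add: P_def)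
  have "v0 \<in> P" using inP[OF v0 x0 i(2)] .
  \<comment> \<open>Otherwise \<open>Z\<close> would separate \<open>P\<close> from the remaining
    vertices: an edge of \<open>H\<close> between them would yield an edge of \<open>G\<close>
    leaving the region without entering \<open>T\<close>.\<close>
  have "P = verts H - Z"
  proof (rule ccontr)
    assume "P \<noteq> verts H - Z"
    moreover have "P \<subseteq> verts H - Z" by (auto simp: P_def)
    moreover have "{u, v} \<notin> edges H" if u: "u \<in> P" and v: "v \<in> verts H - Z - P" for u v
    proof
      assume "{u, v} \<in> edges H"
      then obtain x y where xy: "x \<in> B u" "y \<in> B v" "{x, y} \<in> edges G" using B(4) by blast
      have "x \<in> region i" using xy(1) u by (auto simp: P_def)
      moreover have "y \<notin> T" using avoid[of v] v xy(2) by blast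
      ultimately have "y \<in> region i" using region_closed[OF i(1) _ xy(3)] by simp
      then show False using inP[of v y] v xy(2) by blast
    qed
    ultimately have "separation H Z P (verts H - Z - P)"
      unfolding separation_def using ZH \<open>v0 \<in> P\<close> by blast
    then show False using sep[OF cZ] by (auto simp: separable_def)
  qed
  \<comment> \<open>A branch set of \<open>Z\<close> meets \<open>T\<close>, which lies in
    \<open>K i\<close>. Any other one that misses \<open>K i\<close> would consist of pendants of
    clique \<open>i\<close>.\<close>
  have "B v \<inter> K i \<noteq> {}" if v: "v \<in> verts H" for v
  proof (cases "v \<in> Z")
    case True
    then show ?thesis using T_sub[OF i(1)] by (auto simp: Z_def)
  next
    case False
    then have reg: "B v \<subseteq> region i" using v \<open>P = verts H - Z\<close> by (auto simp: P_def)
    show ?thesis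
    proof
      assume "B v \<inter> K i = {}"
      then have BQ: "B v \<subseteq> {q \<in> Q. blk q = i}" using reg by (auto simp: region_def)
      obtain q where q: "q \<in> B v" using ne[OF v] by blast
      then have qQ: "q \<in> Q" "blk q = i" using BQ by auto
      have nbq: "y \<in> nb q" if "{q, y} \<in> edges G" for y
        using that
      proof (cases rule: edge_cases)
        case (clique j)
        then show ?thesis using K_notin_Q qQ by blast
      next
        case right
        then show ?thesis using nb_sub[of y] K_notin_Q[OF blk_less, of y q] qQ by blast
      qed
      \<comment> \<open>Pendants are pairwise non-adjacent, so a connected set of them is a single
        vertex.\<close>
      have "{q} = B v"
      proof (rule connected_induced_closed[OF B(2)[OF v]])
        fix x y assume "x \<in> {q}" "y \<in> B v" "{x, y} \<in> edges G"
        then have "y \<in> nb q" "y \<in> Q" using nbq BQ by auto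
        then show "y \<in> {q}" using nb_sub[OF qQ(1)] K_notin_Q[OF blk_less, OF qQ(1)] by blast
      qed (use q in auto)
      then have Bv: "B v = {q}" by simp
      \<comment> \<open>The neighbours of \<open>v\<close> have disjoint branch sets that all meet
        \<open>nb q\<close>, which has only \<open>d - 1\<close> elements.\<close>
      have "card (nbrs H v) \<le> card (nb q)"
      proof (rule card_le_if_disjoint_meeting)
        show "finite (nb q)"
          using nb_sub[OF qQ(1)] finite_K[OF blk_less[OF qQ(1)]] by (rule finite_subset)
        show "B u \<inter> nb q \<noteq> {}" if "u \<in> nbrs H v" for u
        proof -
          have "{v, u} \<in> edges H" using that by (simp add: nbrs_def)
          then obtain y where "y \<in> B u" "{q, y} \<in> edges G" using B(4)[of v u] unfolding Bv by blast
          then show ?thesis using nbq by blast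
        qed
        show "B u \<inter> B w = {}" if "u \<in> nbrs H v" "w \<in> nbrs H v" "u \<noteq> w" for u w
        proof -
          have "u \<in> verts H" "w \<in> verts H"
            using that simple_graph_edgeD(3)[OF H(1)] by (auto simp: nbrs_def)
          then show ?thesis using B(3) that(3) by blast
        qed
      qed
      then show False using deg[OF v] card_nb[OF qQ(1)] d_pos by simp
    qed
  qed
  then have "card (verts H) \<le> card (K i)"
    using card_le_if_disjoint_meeting[OF finite_K[OF i(1)], of "verts H" B] B(3) by blast
  then show False using card_K[OF i(1)] H(2) ts by simp
qed

section \<open>Every added edge creates an \<open>H\<close> minor\<close>

text \<open>The point through which \<open>x\<close> enters its clique off the core:
  \<open>x\<close> itself, or for a pendant some neighbour outside \<open>T\<close>.\<close>

lemma port: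
  assumes "i < b" "x \<in> region i"
  obtains x' where "x' \<in> K i" "x' \<notin> T" "x = x' \<or> x \<in> Q \<and> x' \<in> nb x"
proof (cases "x \<in> Q")
  case True
  then have "blk x = i" using assms K_notin_Q by (auto simp: region_def)
  moreover obtain x' where "x' \<in> nb x" "x' \<notin> T" using nb_not_sub[OF True] by blast
  ultimately show thesis using that[of x'] nb_sub[OF True] True by blast
next
  case False
  then show thesis using assms that[of x] by (simp add: region_def)
qed

text \<open>Stated for any \<open>G'\<close> with additional edges, so that a clique of
  \<open>G\<close> can be combined with a set \<open>W\<close> whose connectedness relies on the new
  edge.\<close>

lemma has_minor_attached:
  assumes G': "verts G' = verts G" "edges G \<subseteq> edges G'"
    and H: "simple_graph H" "card (verts H) = s" "w \<in> verts H" "card (nbrs H w) = d"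
    and i: "i < b" "M \<subseteq> K i" "card M = d"
    and W: "W \<subseteq> verts G" "connected_graph (induced G' W)" "W \<inter> K i = {}"
    and M: "\<And>m. m \<in> M \<Longrightarrow> \<exists>x\<in>W. {x, m} \<in> edges G'"
  shows "has_minor G' H"
proof (rule has_minor_clique_plus_connected_set[OF H(1,3) i(2)])
  show "nsets (K i) 2 \<subseteq> edges G'" using clique_edges[OF i(1)] G'(2) by (rule subset_trans)
qed (use assms finite_K card_K K_verts in simp_all)

lemma has_minor_pendant_edge:
  assumes G': "verts G' = verts G" "edges G \<subseteq> edges G'"
    and H: "simple_graph H" "card (verts H) = s" "w \<in> verts H" "card (nbrs H w) = d"
    and xy: "x \<in> Q" "y \<in> K (blk x)" "y \<notin> nb x" "{x, y} \<in> edges G'"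
  shows "has_minor G' H"
proof (rule has_minor_attached[OF G' H blk_less[OF xy(1)]])
  show "insert y (nb x) \<subseteq> K (blk x)" using xy(2) nb_sub[OF xy(1)] by blast
  have "finite (nb x)"
    using nb_sub[OF xy(1)] finite_K[OF blk_less[OF xy(1)]] by (rule finite_subset)
  then show "card (insert y (nb x)) = d" using card_nb[OF xy(1)] xy(3) d_pos by simp
  show "{x} \<subseteq> verts G" using xy(1) by (simp add: verts_G)
  show "{x} \<inter> K (blk x) = {}" using K_notin_Q[OF blk_less] xy(1) by blast
  show "\<exists>u\<in>{x}. {u, m} \<in> edges G'" if "m \<in> insert y (nb x)" for m
    using that xy pendant_edge G'(2) by auto
qed (rule connected_induced_singleton)

text \<open>Of two distinct sets of equal size, \<open>nb y\<close> has an element outside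
  \<open>nb x\<close>, so \<open>x\<close> and \<open>y\<close> together see \<open>d\<close>
  vertices of the clique.\<close>

lemma has_minor_two_pendants:
  assumes G': "verts G' = verts G" "edges G \<subseteq> edges G'"
    and H: "simple_graph H" "card (verts H) = s" "w \<in> verts H" "card (nbrs H w) = d"
    and xy: "x \<in> Q" "y \<in> Q" "blk x = blk y" "x \<noteq> y" "{x, y} \<in> edges G'"
  shows "has_minor G' H"
proof -
  have fin: "finite (nb x)"
    using nb_sub[OF xy(1)] finite_K[OF blk_less[OF xy(1)]] by (rule finite_subset)
  have "nb x \<noteq> nb y" using inj_onD[OF inj_nb _ xy(1,2)] xy(3,4) by auto
  then have "\<not> nb y \<subseteq> nb x"
    using card_subset_eq[OF fin] card_nb[OF xy(1)] card_nb[OF xy(2)] by auto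
  then obtain a where a: "a \<in> nb y" "a \<notin> nb x" by blast
  show ?thesis
  proof (rule has_minor_attached[OF G' H blk_less[OF xy(1)]])
    show "insert a (nb x) \<subseteq> K (blk x)"
      using a(1) nb_sub[OF xy(2)] nb_sub[OF xy(1)] xy(3) by auto
    show "card (insert a (nb x)) = d" using card_nb[OF xy(1)] a(2) d_pos fin by simp
    show "{y, x} \<subseteq> verts G" using xy(1,2) by (simp add: verts_G)
    show "{y, x} \<inter> K (blk x) = {}" using K_notin_Q[OF blk_less[OF xy(1)]] xy(1,2) by blast
    show "connected_graph (induced G' {y, x})"
      using connected_induced_insert[OF connected_induced_singleton _ xy(5)] by simp
    show "\<exists>u\<in>{y, x}. {u, m} \<in> edges G'" if "m \<in> insert a (nb x)" for m
      using that a(1) xy(1,2) pendant_edge G'(2) by blast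
  qed
qed

text \<open>The ports give a walk \<open>x'\<close>, \<open>x\<close>, \<open>y\<close>,
  \<open>y'\<close> from one clique to the other. If \<open>H\<close> has a separator of size
  \<open>Suc (card T)\<close>, the walk serves as link between the two cliques. Otherwise
  \<open>card T = d - 1\<close>, and the part of the walk outside \<open>K i\<close> is adjacent to
  \<open>T\<close> and to \<open>x'\<close>, which are \<open>d\<close> vertices of
  \<open>K i\<close>.\<close>

lemma has_minor_cross_edge:
  assumes G': "verts G' = verts G" "edges G \<subseteq> edges G'"
    and H: "simple_graph H" "card (verts H) = s" "w \<in> verts H" "card (nbrs H w) = d"
    and sep: "card T = d - 1 \<or> separable H (Suc (card T))"
    and ij: "i < b" "j < b" "i \<noteq> j"
    and xy: "x \<in> region i" "y \<in> region j" "{x, y} \<in> edges G'"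
  shows "has_minor G' H"
proof -
  obtain x' where x': "x' \<in> K i" "x' \<notin> T" "x = x' \<or> x \<in> Q \<and> x' \<in> nb x"
    using port[OF ij(1) xy(1)] .
  obtain y' where y': "y' \<in> K j" "y' \<notin> T" "y = y' \<or> y \<in> Q \<and> y' \<in> nb y"
    using port[OF ij(2) xy(2)] .
  have e: "x = x' \<or> {x', x} \<in> edges G'" "y = y' \<or> {y, y'} \<in> edges G'"
    using x'(3) y'(3) pendant_edge[of x x'] pendant_edge[of y y'] G'(2)
    by (auto simp: insert_commute)
  have KK: "K i \<inter> K j = T" using K_Int ij by blast
  have out: "x' \<notin> K j" "y' \<notin> K i" using x' y' KK by blast+
  have out': "x \<notin> K j" "y \<notin> K i" "x \<in> K i \<Longrightarrow> x = x'" "y \<in> K j \<Longrightarrow> y = y'"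
    using x' y' out K_notin_Q ij(1,2) by blast+
  have V: "x \<in> verts G" "x' \<in> verts G" "y \<in> verts G" "y' \<in> verts G"
    using x' y' K_verts ij(1,2) by (auto simp: verts_G)
  have grow: "connected_graph (induced G' (insert v S))"
    if "connected_graph (induced G' S)" "u \<in> S" "v = u \<or> {u, v} \<in> edges G'" for u v S
    using that connected_induced_insert[OF that(1,2)] by (auto simp: insert_absorb)
  show ?thesis
  proof (cases "separable H (Suc (card T))")
    case True
    \<comment> \<open>Consecutive vertices may coincide, which \<open>grow\<close> allows for. The
      walk meets \<open>K i\<close> only in \<open>x'\<close> and \<open>K j\<close> only in
      \<open>y'\<close>.\<close>
    let ?W = "insert y' (insert y (insert x {x'}))"
    have "connected_graph (induced G' (insert x {x'}))"
      using e(1) by (intro grow[OF connected_induced_singleton, of x']) auto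
    then have "connected_graph (induced G' (insert y (insert x {x'})))"
      by (rule grow[where u = x]) (use xy(3) in auto)
    then have conn: "connected_graph (induced G' ?W)"
      by (rule grow[where u = y]) (use e(2) in auto)
    show ?thesis
    proof (rule has_minor_two_linked_cliques[where ?K1.0 = "K i" and ?K2.0 = "K j", OF H(1) _ _ _ _ _ _ _ _ _ _ conn])
      show "?W \<inter> K i = {x'}" "?W \<inter> K j = {y'}" using x' y' out out' by blast+
      show "nsets (K i) 2 \<subseteq> edges G'" "nsets (K j) 2 \<subseteq> edges G'"
        using clique_edges ij G'(2) by blast+
    qed (use True KK ij finite_K card_K K_verts G'(1) H(2) out V in simp_all)
  next
    case False
    then have t: "card T = d - 1" using sep by blast
    have cM: "card (insert x' T) = d" using t d_pos x'(2) finite_T by simp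
    have sub: "insert x' T \<subseteq> K i" using x'(1) T_sub[OF ij(1)] by blast
    have y'T: "{y', m} \<in> edges G'" if "m \<in> T" for m
    proof -
      have "{y', m} \<in> nsets (K j) 2" using that y' T_sub[OF ij(2)] by auto
      then show ?thesis using clique_edges[OF ij(2)] G'(2) by blast
    qed
    show ?thesis
    \<comment> \<open>If \<open>x\<close> is a clique vertex, it belongs to the target set and stays
      out of \<open>W\<close>; a pendant \<open>x\<close> has to join \<open>W\<close> in order to
      reach \<open>x'\<close>.\<close>
    proof (cases "x = x'")
      case True
      have conn: "connected_graph (induced G' (insert y' {y}))"
        by (rule grow[OF connected_induced_singleton, of y]) (use e(2) in auto)
      show ?thesis
      proof (rule has_minor_attached[OF G' H ij(1) sub cM _ conn])
        show "insert y' {y} \<inter> K i = {}" using out out' by blast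
        show "\<exists>u\<in>insert y' {y}. {u, m} \<in> edges G'" if "m \<in> insert x' T" for m
          using that y'T xy(3) True by (auto simp: insert_commute)
      qed (use V in simp)
    next
      case False
      have "connected_graph (induced G' (insert y {x}))"
        by (rule grow[OF connected_induced_singleton, of x]) (use xy(3) in auto)
      then have conn: "connected_graph (induced G' (insert y' (insert y {x})))"
        by (rule grow[where u = y]) (use e(2) in auto)
      show ?thesis
      proof (rule has_minor_attached[OF G' H ij(1) sub cM _ conn])
        show "insert y' (insert y {x}) \<inter> K i = {}" using out out' False by blast
        show "\<exists>u\<in>insert y' (insert y {x}). {u, m} \<in> edges G'" if "m \<in> insert x' T" for m
          using that y'T e(1) False by (auto simp: insert_commute)
      qed (use V in simp)
    qed
  qed
qed

lemma has_minor_add_edge: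
  assumes H: "simple_graph H" "card (verts H) = s" "w \<in> verts H" "card (nbrs H w) = d"
    and sep: "card T = d - 1 \<or> separable H (Suc (card T))"
    and xy: "x \<in> verts G" "y \<in> verts G" "x \<noteq> y" "{x, y} \<notin> edges G"
  shows "has_minor (add_edge G {x, y}) H"
proof -
  let ?G' = "add_edge G {x, y}"
  have G': "verts ?G' = verts G" "edges G \<subseteq> edges ?G'" "{x, y} \<in> edges ?G'" "{y, x} \<in> edges ?G'"
    by (auto simp: add_edge_def insert_commute)
  have noclique: False if "i < b" "x \<in> K i" "y \<in> K i" for i
  proof -
    have "{x, y} \<in> nsets (K i) 2" using that xy(3) by simp
    then show False using clique_edges[OF that(1)] xy(4) by blast
  qed
  have nonb: "x \<in> Q \<Longrightarrow> y \<notin> nb x" "y \<in> Q \<Longrightarrow> x \<notin> nb y"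
    using pendant_edge[of x y] pendant_edge[of y x] xy(4) by (auto simp: insert_commute)
  \<comment> \<open>A pendant joined to its own clique is settled first; after that no end of the
    new edge can lie in \<open>T\<close>.\<close>
  consider "x \<in> Q" "y \<in> K (blk x)" | "y \<in> Q" "x \<in> K (blk y)"
    | "x \<in> Q \<Longrightarrow> y \<notin> K (blk x)" "y \<in> Q \<Longrightarrow> x \<notin> K (blk y)" by blast
  then show ?thesis
  proof cases
    case 1
    then show ?thesis using has_minor_pendant_edge[OF G'(1,2) H] nonb(1) G'(3) by blast
  next
    case 2
    then show ?thesis using has_minor_pendant_edge[OF G'(1,2) H] nonb(2) G'(4) by blast
  next
    case 3
    have "x \<notin> T"
    proof
      assume "x \<in> T"
      then have "y \<notin> Q" using 3(2) T_sub[OF blk_less] by blast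
      then show False using noclique \<open>x \<in> T\<close> T_sub xy(2) by (auto simp: verts_G)
    qed
    have "y \<notin> T"
    proof
      assume "y \<in> T"
      then have "x \<notin> Q" using 3(1) T_sub[OF blk_less] by blast
      then show False using noclique \<open>y \<in> T\<close> T_sub xy(1) by (auto simp: verts_G)
    qed
    obtain i where i: "i < b" "x \<in> region i" using region_cover[OF xy(1) \<open>x \<notin> T\<close>] .
    obtain j where j: "j < b" "y \<in> region j" using region_cover[OF xy(2) \<open>y \<notin> T\<close>] .
    show ?thesis
    proof (cases "i = j")
      case False
      then show ?thesis
        using has_minor_cross_edge[OF G'(1,2) H sep i(1) j(1) _ i(2) j(2) G'(3)] by blast
    next
      case True
      \<comment> \<open>In a common region both ends are pendants: two vertices of one clique are
        already adjacent, and a pendant with a vertex of its clique is excluded by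
        \<open>3\<close>.\<close>
      then have "x \<in> Q \<and> y \<in> Q \<and> blk x = blk y"
        using i j 3 noclique[OF i(1)] by (auto simp: region_def)
      then show ?thesis using has_minor_two_pendants[OF G'(1,2) H _ _ _ xy(3) G'(3)] by blast
    qed
  qed
qed

end

section \<open>The choice of \<open>t\<close>, and the construction on an initial segment of the
  naturals\<close>

text \<open>Take \<open>t\<close> one below the least size of a separator, or \<open>m\<close> if no
  separator has size at most \<open>m\<close>. The predecessor exists because size \<open>0\<close>
  is excluded.\<close>

lemma exists_separability_threshold:
  assumes "\<not> separable H 0"
  obtains t where "t \<le> m" "\<And>k. k \<le> t \<Longrightarrow> \<not> separable H k" "t = m \<or> separable H (Suc t)"
proof (cases "\<exists>k\<le>m. separable H k")
  case False
  then show thesis using that[of m] by blast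
next
  case True
  define k where "k = (LEAST k. separable H k)"
  have k: "separable H k" "\<And>j. separable H j \<Longrightarrow> k \<le> j"
    using True unfolding k_def by (auto intro: LeastI Least_le)
  then obtain t where t: "k = Suc t" using assms by (cases k) auto
  have "k \<le> m" using True k(2) by (auto intro: order_trans)
  moreover have "\<not> separable H j" if "j \<le> t" for j using k(2)[of j] t that by auto
  ultimately show thesis using that[of t] k(1) t by simp
qed

lemma sat_le_card_edges:
  assumes "saturated \<F> (G :: nat ugraph)"
  shows "sat (card (verts G)) \<F> \<le> card (edges G)"
  unfolding sat_def by (rule cInf_lower) (use assms in auto)

text \<open>The core comes first, then \<open>b\<close> intervals of length \<open>c\<close>, then
  the pendants. The bound on \<open>p\<close> is the number of pairs of a clique index and a
  \<open>(d - 1)\<close>-subset of that clique not inside the core, so each pendant gets a pair of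
  its own.\<close>

lemma exists_glued_cliques_nat:
  fixes t d s b p :: nat
  defines "c \<equiv> s - 1 - t"
  assumes "0 < b" "0 < d" "t < s - 1" and p: "p \<le> b * ((s - 1 choose (d - 1)) - (t choose (d - 1)))"
  obtains K Q blk nb where "glued_cliques {..<t} K b Q blk nb d s"
    "card Q = p" "(\<Union>i<b. K i) \<union> Q = {..<t + b * c + p}"
proof -
  have c: "0 < c" "t + c = s - 1" using assms(4) by (auto simp: c_def)
  define leg where "leg i = {t + i * c..<t + i * c + c}" for i
  define K where "K i = {..<t} \<union> leg i" for i
  define Q where "Q = {t + b * c..<t + b * c + p}"
  \<comment> \<open>Legs are the fibres of a division, which yields both their disjointness and the
    covering of the segment.\<close>
  have leg_div: "x \<in> leg i \<longleftrightarrow> t \<le> x \<and> (x - t) div c = i" for x i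
  proof
    assume x: "x \<in> leg i"
    then have "(x - t) div c = i" by (intro div_nat_eqI) (auto simp: leg_def mult.commute)
    with x show "t \<le> x \<and> (x - t) div c = i" by (auto simp: leg_def)
  next
    assume x: "t \<le> x \<and> (x - t) div c = i"
    then show "x \<in> leg i"
      using div_times_less_eq_dividend[of "x - t" c] dividend_less_div_times[OF c(1), of "x - t"]
      by (auto simp: leg_def simp del: div_times_less_eq_dividend)
  qed
  have le_b: "i * c + c \<le> b * c" if "i < b" for i
    using mult_le_mono1[of "Suc i" b c] that by simp
  have finK: "finite (K i)" for i by (simp add: K_def leg_def)
  have cardK: "card (K i) = s - 1" for i
    unfolding K_def by (subst card_Un_disjoint) (use c(2) in \<open>auto simp: leg_def\<close>)
  define slots where "slots i = nsets (K i) (d - 1) - nsets {..<t} (d - 1)" for i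
  have "card (slots i) = (s - 1 choose (d - 1)) - (t choose (d - 1))" for i
    unfolding slots_def
    by (subst card_Diff_subset) (simp_all add: finite_imp_finite_nsets nsets_mono K_def[of i]
        cardK[unfolded K_def])
  then have "card (SIGMA i:{..<b}. slots i) = b * ((s - 1 choose (d - 1)) - (t choose (d - 1)))"
    by (subst card_SigmaI) (simp_all add: slots_def finite_imp_finite_nsets finK)
  then have "card Q \<le> card (SIGMA i:{..<b}. slots i)" using p by (simp add: Q_def)
  moreover have "finite (SIGMA i:{..<b}. slots i)"
    by (simp add: slots_def finite_imp_finite_nsets finK)
  ultimately obtain g where g: "inj_on g Q" "g ` Q \<subseteq> (SIGMA i:{..<b}. slots i)"
    using inj_on_iff_card_le[of Q "SIGMA i:{..<b}. slots i"] by (auto simp: Q_def)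
  have gq: "fst (g q) < b" "snd (g q) \<subseteq> K (fst (g q))" "card (snd (g q)) = d - 1"
    "\<not> snd (g q) \<subseteq> {..<t}" if "q \<in> Q" for q
  proof -
    have "g q \<in> (SIGMA i:{..<b}. slots i)" using g(2) that by blast
    then show "fst (g q) < b" "snd (g q) \<subseteq> K (fst (g q))" "card (snd (g q)) = d - 1"
      "\<not> snd (g q) \<subseteq> {..<t}"
      by (auto simp: slots_def nsets_def)
  qed
  have "glued_cliques {..<t} K b Q (\<lambda>q. fst (g q)) (\<lambda>q. snd (g q)) d s"
  proof
    show "K i \<inter> K j = {..<t}" if "i \<noteq> j" for i j
      using that by (auto simp: K_def leg_div)
    show "Q \<inter> K i = {}" if "i < b" for i
      using le_b[OF that] by (auto simp: K_def Q_def leg_def)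
    show "inj_on (\<lambda>q. (fst (g q), snd (g q))) Q" using g(1) by simp
  qed (use assms(2,3) gq finK cardK in \<open>simp_all add: K_def Q_def\<close>)
  moreover have "(\<Union>i<b. K i) = {..<t + b * c}"
  proof (intro equalityI subsetI)
    fix x assume "x \<in> (\<Union>i<b. K i)"
    then obtain i where "i < b" "x \<in> K i" by blast
    then show "x \<in> {..<t + b * c}" using le_b[of i] by (auto simp: K_def leg_def)
  next
    fix x assume x: "x \<in> {..<t + b * c}"
    show "x \<in> (\<Union>i<b. K i)"
    proof (cases "x < t")
      case True
      then show ?thesis using assms(2) by (auto simp: K_def)
    next
      case False
      then have "(x - t) div c < b" using x c(1) by (simp add: div_less_iff_less_mult)
      then show ?thesis using False by (auto simp: K_def leg_div)
    qed
  qed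
  then have "(\<Union>i<b. K i) \<union> Q = {..<t + b * c + p}" by (auto simp: Q_def)
  ultimately show thesis using that[of K Q] by (simp add: Q_def)
qed

section \<open>Binomial estimates\<close>

lemma real_choose_two: "real (n choose 2) = real n * (real n - 1) / 2"
  by (induction n) (simp_all add: numeral_2_eq_2 field_simps)

text \<open>The two nonnegative quantities are \<open>(s - d choose 2)\<close> and \<open>(d - t choose 2)\<close>.\<close>

lemma excess_bounds:
  fixes d s t :: nat
  assumes "t < d" "d < s"
  defines "X \<equiv> real (s - 1 choose 2) + real (d choose 2) - (real d - 1) * (real s - 1)"
  shows "0 \<le> X"
    and "real (s - 1 choose 2) - real (t choose 2) - (real d - 1) * (real s - 1 - real t) \<le> X"
proof -
  have s: "real (s - 1) = real s - 1" using assms(2) by simp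
  have "X = (real s - real d) * (real s - real d - 1) / 2"
    unfolding X_def real_choose_two s by (simp add: field_simps)
  also have "\<dots> \<ge> 0"
    using assms(2) by (intro divide_nonneg_nonneg mult_nonneg_nonneg) auto
  finally show "0 \<le> X" .
  have "X - (real (s - 1 choose 2) - real (t choose 2) - (real d - 1) * (real s - 1 - real t))
      = (real d - real t) * (real d - real t - 1) / 2"
    unfolding X_def real_choose_two s by (simp add: field_simps)
  also have "\<dots> \<ge> 0"
    using assms(1) by (intro divide_nonneg_nonneg mult_nonneg_nonneg) auto
  finally show "real (s - 1 choose 2) - real (t choose 2) - (real d - 1) * (real s - 1 - real t) \<le> X"
    by simp
qed

text \<open>Pascal's rule gives two positive summands. For \<open>t = d - 1\<close> this leaves room
  for a pendant even after \<open>T\<close> itself is excluded as a neighbourhood.\<close>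

lemma one_less_binomial:
  assumes "0 < k" "k < m"
  shows "1 < (m choose k)"
proof -
  obtain m' k' where "m = Suc m'" "k = Suc k'" using assms by (metis Suc_pred less_trans)
  then have "0 < (m' choose k')" "0 < (m' choose Suc k')"
      "m choose k = (m' choose k') + (m' choose Suc k')" using assms by auto
  then show ?thesis by linarith
qed

section \<open>The upper bound on the saturation number\<close>

lemma sat_minor_class_le:
  fixes H :: "'a ugraph" and d s t n :: nat
  assumes H: "simple_graph H" "card (verts H) = s" "w \<in> verts H" "card (nbrs H w) = d"
    and deg: "\<And>v. v \<in> verts H \<Longrightarrow> d \<le> card (nbrs H v)"
    and d: "0 < d" "d < s"
    and t: "t < d" "\<And>k. k \<le> t \<Longrightarrow> \<not> separable H k" "t = d - 1 \<or> separable H (Suc t)"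
    and n: "n = t + b * (s - 1 - t) + p" "0 < b"
      "p \<le> b * ((s - 1 choose (d - 1)) - (t choose (d - 1)))"
  shows "sat n (minor_class H)
    \<le> (t choose 2) + b * ((s - 1 choose 2) - (t choose 2)) + p * (d - 1)"
proof -
  have ts: "t < s - 1" using t d by simp
  obtain K Q blk nb where gc: "glued_cliques {..<t} K b Q blk nb d s"
    and Q: "card Q = p" and V: "(\<Union>i<b. K i) \<union> Q = {..<n}"
    using exists_glued_cliques_nat[OF n(2) d(1) ts n(3)] n(1) by metis
  interpret glued_cliques "{..<t}" K b Q blk nb d s by (rule gc)
  have "\<not> has_minor G H"
    using not_has_minor[OF H(1,2) deg] t(1,2) d by simp
  moreover have "\<exists>F\<in>minor_class H. contains (add_edge G e) F"
    if e: "e \<in> nsets (verts G) 2 - edges G" for e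
  proof -
    obtain x y where xy: "e = {x, y}" "x \<noteq> y" using e by (auto simp: nsets_def card_2_iff)
    then have xyV: "x \<in> verts G" "y \<in> verts G" "{x, y} \<notin> edges G" using e by auto
    have "simple_graph (add_edge G e)"
      using simple_graph_G e by (auto simp: simple_graph_def add_edge_def)
    moreover have "has_minor (add_edge G e) H"
      unfolding xy(1) using has_minor_add_edge[OF H _ xyV(1,2) xy(2) xyV(3)] t(3) by simp
    ultimately show ?thesis using exists_contains_minor_class_iff H(1) by blast
  qed
  ultimately have "saturated (minor_class H) G"
    using exists_contains_minor_class_iff[OF simple_graph_G H(1)] simple_graph_G
    unfolding saturated_def by blast
  from sat_le_card_edges[OF this] have "sat n (minor_class H) \<le> card (edges G)"
    using V by (simp add: verts_G)
  also note card_edges_G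
  finally show ?thesis using Q by simp
qed

theorem theorem2p2:
  fixes H :: "'a ugraph" and d s :: nat
  assumes "simple_graph H" and "connected_graph H"
    and "d = min_degree H" and "d \<ge> 3" and "s = card (verts H)"
  shows "\<exists>C :: real. \<forall>n :: nat.
    real (sat n (minor_class H)) \<le>
      ((real d - 1) +
        (real ((s - 1) choose 2) + real (d choose 2) - (real d - 1) * (real s - 1)) /
        (real ((s - 1) choose (d - 1)) + (real s - 1) - real d)) * real n + C"
proof -
  have fin: "finite (verts H)" and ne: "verts H \<noteq> {}"
    using assms(1,2) by (auto simp: simple_graph_def connected_graph_def)
  have "d \<in> degree H ` verts H"
    using assms(3) fin ne by (simp add: min_degree_def)
  then obtain w where w: "w \<in> verts H" "card (nbrs H w) = d"
    using degree_eq_card_nbrs[OF assms(1)] by auto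
  have deg: "d \<le> card (nbrs H v)" if "v \<in> verts H" for v
    using that assms(3) fin by (simp add: min_degree_def flip: degree_eq_card_nbrs[OF assms(1)])
  have "nbrs H w \<subseteq> verts H - {w}"
    using simple_graph_edgeD[OF assms(1)] by (auto simp: nbrs_def)
  then have "d \<le> card (verts H - {w})" using w(2) fin by (metis card_mono finite_Diff)
  then have ds: "d < s"
    using w(1) fin assms(5) by (metis card_Diff1_less le_less_trans)
  have d0: "0 < d" using assms(4) by simp
  obtain t where t: "t \<le> d - 1" "\<And>k. k \<le> t \<Longrightarrow> \<not> separable H k" "t = d - 1 \<or> separable H (Suc t)"
    using exists_separability_threshold[OF connected_not_separable_0[OF assms(2,1)]] by metis
  have td: "t < d" using t(1) d0 by simp
  \<comment> \<open>\<open>J\<close> is the number of pendants that one clique can carry and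
    \<open>c\<close> the number of its vertices off the core, so \<open>L\<close> is the size of a
    full block. \<open>X\<close> and \<open>N\<close> are the numerator and denominator of the
    claimed fraction.\<close>
  define A where "A = (s - 1 choose (d - 1))"
  define J where "J = A - (t choose (d - 1))"
  define c where "c = s - 1 - t"
  define L where "L = c + J"
  define X where "X = real (s - 1 choose 2) + real (d choose 2) - (real d - 1) * (real s - 1)"
  define N where "N = real A + (real s - 1) - real d"
  have A: "1 < A" unfolding A_def using assms(4) ds by (intro one_less_binomial) auto
  \<comment> \<open>The second part says that full blocks have at least \<open>N\<close> vertices.
    It is an equality for \<open>t = d - 1\<close>, where \<open>J = A - 1\<close>; for smaller
    \<open>t\<close> no neighbourhood is lost and \<open>c\<close> is larger.\<close>
  have J: "0 < J \<and> A + (s - 1) - d \<le> L"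
  proof (cases "t = d - 1")
    case True
    then show ?thesis using A ds d0 by (auto simp: J_def L_def c_def)
  next
    case False
    then have "(t choose (d - 1)) = 0" using t(1) by (simp add: binomial_eq_0)
    then have "J = A" unfolding J_def by (simp only: diff_zero)
    then show ?thesis using A td by (auto simp: L_def c_def)
  qed
  have N: "0 < N" "N \<le> real L" using J A ds by (auto simp: N_def)
  have X: "0 \<le> X"
    "real (s - 1 choose 2) - real (t choose 2) - (real d - 1) * (real s - 1 - real t) \<le> X"
    unfolding X_def by (rule excess_bounds[OF td ds])+
  have T_le: "(t choose 2) \<le> (s - 1 choose 2)" using td ds by (intro binomial_right_mono) auto
  \<comment> \<open>The finite sum absorbs the small \<open>n\<close>, where the cliques may not
    fit; the other terms pay for the core and for one incomplete block.\<close>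
  define C where "C = real (\<Sum>n<t + c * L. sat n (minor_class H)) + real (t choose 2) + X"
  have "real (sat n (minor_class H)) \<le> ((real d - 1) + X / N) * real n + C" for n
  proof (cases "n < t + c * L")
    case True
    then have "sat n (minor_class H) \<le> (\<Sum>n<t + c * L. sat n (minor_class H))"
      by (intro member_le_sum) auto
    moreover have "0 \<le> ((real d - 1) + X / N) * real n" using d0 X(1) N(1) by simp
    moreover have "0 \<le> real (t choose 2) + X" using X(1) by simp
    ultimately show ?thesis unfolding C_def by linarith
  next
    case False
    \<comment> \<open>\<open>q\<close> counts the full blocks; one more clique gives room for all
      remaining vertices as pendants.\<close>
    define q where "q = (n - t) div L"
    define b where "b = Suc q"
    define p where "p = n - t - b * c"
    have L: "0 < L" using J by (simp add: L_def)
    have q: "q * L \<le> n - t" "n - t < b * L"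
      using L dividend_less_div_times[of L "n - t"] by (auto simp: q_def b_def)
    \<comment> \<open>Since \<open>q\<close> is at least \<open>c\<close>, the \<open>c\<close>
      vertices of the extra clique can be taken from the at least \<open>q\<close> pendant places of
      the full blocks.\<close>
    have "c * L \<le> n - t" using False by simp
    then have "c \<le> q" using L by (simp add: q_def less_eq_div_iff_mult_less_eq)
    also have "q \<le> q * J" using J by simp
    finally have "b * c \<le> q * L" by (simp add: b_def L_def distrib_left)
    then have bc: "b * c \<le> n - t" using q(1) by linarith
    have n: "n = t + b * c + p" using bc False by (simp add: p_def)
    have p: "p \<le> b * J" using q(2) by (simp add: p_def L_def distrib_left)
    have "sat n (minor_class H)
        \<le> (t choose 2) + b * ((s - 1 choose 2) - (t choose 2)) + p * (d - 1)"
      by (rule sat_minor_class_le[OF assms(1) assms(5)[symmetric] w deg d0 ds td t(2,3)])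
        (use n p in \<open>simp_all add: b_def c_def J_def A_def\<close>)
    then have "real (sat n (minor_class H)) \<le>
        real ((t choose 2) + b * ((s - 1 choose 2) - (t choose 2)) + p * (d - 1))"
      by (rule of_nat_mono)
    also have "\<dots> = real (t choose 2) + real b * (real (s - 1 choose 2) - real (t choose 2))
        + real p * (real d - 1)"
      using T_le d0 by simp
    also have "real p = real n - real t - real b * (real s - 1 - real t)"
      using n td ds by (simp add: c_def)
    \<comment> \<open>Charging \<open>d - 1\<close> edges to every vertex off the core isolates the
      excess of each clique, which is at most \<open>X\<close>.\<close>
    also have "real (t choose 2) + real b * (real (s - 1 choose 2) - real (t choose 2))
        + (real n - real t - real b * (real s - 1 - real t)) * (real d - 1)
      = real (t choose 2) + (real d - 1) * (real n - real t)
        + real b * (real (s - 1 choose 2) - real (t choose 2) - (real d - 1) * (real s - 1 - real t))"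
      by (simp add: algebra_simps)
    also have "\<dots> \<le> real (t choose 2) + (real d - 1) * real n + (real n / N + 1) * X"
    proof -
      \<comment> \<open>Full blocks have at least \<open>N\<close> vertices, so there are at most
        \<open>real n / N + 1\<close> cliques.\<close>
      have "real q * N \<le> real q * real L" using N(2) by (intro mult_left_mono) auto
      also have "\<dots> \<le> real n" using q(1) by (metis diff_le_self le_trans of_nat_le_iff of_nat_mult)
      finally have "real b \<le> real n / N + 1" using N(1) by (simp add: b_def field_simps)
      then have "real b * X \<le> (real n / N + 1) * X" using X(1) by (rule mult_right_mono)
      moreover have "real b * (real (s - 1 choose 2) - real (t choose 2)
          - (real d - 1) * (real s - 1 - real t)) \<le> real b * X"
        using X(2) by (rule mult_left_mono) simp
      moreover have "(real d - 1) * (real n - real t) \<le> (real d - 1) * real n"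
        using d0 by (intro mult_left_mono) auto
      ultimately show ?thesis by linarith
    qed
    also have "\<dots> = ((real d - 1) + X / N) * real n + (real (t choose 2) + X)"
      by (simp add: algebra_simps)
    also have "\<dots> \<le> ((real d - 1) + X / N) * real n + C" by (simp add: C_def sum_nonneg)
    finally show ?thesis .
  qed
  then show ?thesis unfolding X_def N_def A_def by blast
qed

end
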